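(* Every $d$-regular graph $G$ satisfies $\mathrm{wd}(G)\ge \lfloor d/2\rfloor+1$.
   Context: All graphs are finite and simple. A graph $G$ is $d$-regular if every vertex of $G$ has degree $d$. $\mathbb{N}$ denotes the nonnegative integers. Operation $\mathrm{Delete}(G,f,u)$: given a graph $G$, a function $f:V(G)\to\mathbb{N}$ and a vertex $u\in V(G)$, it outputs the graph $G'=G-u$ and the function $f':V(G')\to\mathbb{Z}$ with $f'(v)=f(v)-1$ if $uv\in E(G)$ and $f'(v)=f(v)$ otherwise. It is legal if $f'$ is nonnegative. Operation $\mathrm{DeleteSave}(G,f,u,w)$: given a graph $G$, a function $f:V(G)\to\mathbb{N}$ and adjacent vertices $u,w\in V(G)$, it outputs $G'=G-u$ and $f':V(G')\to\mathbb{Z}$ with $f'(v)=f(v)-1$ if $uv\in E(G)$ and $v\ne w$, and $f'(v)=f(v)$ otherwise. It is legal if $f(u)>f(w)$ and $f'$ is nonnegative. $G$ is weakly $f$-degenerate if it is possible to remove all vertices from $G$ by a sequence of legal applications of Delete and DeleteSave, starting from $(G,f)$, each operation being applied to the graph and function output by the previous one. For $k\in\mathbb{N}$, $G$ is weakly $k$-degenerate if it is weakly $f$-degenerate for the constant function $f\equiv k$. The weak degeneracy $\mathrm{wd}(G)$ is the minimum integer $k$ such that $G$ is weakly $k$-degenerate.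
   Formalization: The formal statement assumes d ≥ 1 and that G has at least one vertex; the claim fails otherwise, since an edgeless graph (0-regular) and the empty graph have weak degeneracy 0. *)

theory Defs
  imports "Graph_Theory.Digraph"
begin

text \<open>
  A finite simple graph is rendered by the locale predicate \<^const>\<open>graph\<close>: a finite, loop-free,
  symmetric digraph without parallel arcs, each undirected edge being a pair of opposite arcs.
  Thus \<open>u \<rightarrow>\<^bsub>G\<^esub> v\<close> is adjacency and \<^const>\<open>out_degree\<close> counts neighbours.
\<close>

definition regular_graph :: "nat \<Rightarrow> ('a, 'b) pre_digraph \<Rightarrow> bool" where
  "regular_graph d G \<longleftrightarrow> (\<forall>v\<in>verts G. out_degree G v = d)"

definition Delete ::
  "('a, 'b) pre_digraph \<Rightarrow> ('a \<Rightarrow> nat) \<Rightarrow> 'a \<Rightarrow> ('a, 'b) pre_digraph \<times> ('a \<Rightarrow> int)" where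
  "Delete G f u =
    (pre_digraph.del_vert G u,
     \<lambda>v. if u \<rightarrow>\<^bsub>G\<^esub> v then int (f v) - 1 else int (f v))"

definition DeleteSave ::
  "('a, 'b) pre_digraph \<Rightarrow> ('a \<Rightarrow> nat) \<Rightarrow> 'a \<Rightarrow> 'a \<Rightarrow> ('a, 'b) pre_digraph \<times> ('a \<Rightarrow> int)" where
  "DeleteSave G f u w =
    (pre_digraph.del_vert G u,
     \<lambda>v. if u \<rightarrow>\<^bsub>G\<^esub> v \<and> v \<noteq> w then int (f v) - 1 else int (f v))"

text \<open>
  Functions on the vertex set are total functions whose values outside \<open>verts G\<close> are irrelevant;
  in particular nonnegativity is only required on the remaining vertices, and there
  \<open>nat \<circ> f'\<close> is just \<open>f'\<close> read as a function into the naturals.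
\<close>

inductive legal_step ::
  "('a, 'b) pre_digraph \<times> ('a \<Rightarrow> nat) \<Rightarrow> ('a, 'b) pre_digraph \<times> ('a \<Rightarrow> nat) \<Rightarrow> bool" where
  legal_Delete:
    "\<lbrakk>u \<in> verts G; Delete G f u = (G', f'); \<forall>v\<in>verts G'. f' v \<ge> 0\<rbrakk>
      \<Longrightarrow> legal_step (G, f) (G', nat \<circ> f')"
| legal_DeleteSave:
    "\<lbrakk>u \<in> verts G; w \<in> verts G; u \<rightarrow>\<^bsub>G\<^esub> w; DeleteSave G f u w = (G', f');
      f u > f w; \<forall>v\<in>verts G'. f' v \<ge> 0\<rbrakk>
      \<Longrightarrow> legal_step (G, f) (G', nat \<circ> f')"

definition weakly_f_degenerate :: "('a, 'b) pre_digraph \<Rightarrow> ('a \<Rightarrow> nat) \<Rightarrow> bool" where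
  "weakly_f_degenerate G f \<longleftrightarrow> (\<exists>H g. legal_step\<^sup>*\<^sup>* (G, f) (H, g) \<and> verts H = {})"

definition weakly_degenerate :: "('a, 'b) pre_digraph \<Rightarrow> nat \<Rightarrow> bool" where
  "weakly_degenerate G k \<longleftrightarrow> weakly_f_degenerate G (\<lambda>_. k)"

definition weak_degeneracy :: "('a, 'b) pre_digraph \<Rightarrow> nat" where
  "weak_degeneracy G = (LEAST k. weakly_degenerate G k)"

text \<open>The minimum defining the weak degeneracy is attained for every graph with finite vertex set.\<close>

lemma weakly_f_degenerate_if_ge_card:
  assumes "finite (verts G)" "\<forall>v\<in>verts G. card (verts G) \<le> f v"
  shows "weakly_f_degenerate G f"
  using assms
proof (induction "card (verts G)" arbitrary: G f)
  case 0
  then show ?case by (auto simp: weakly_f_degenerate_def)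
next
  case (Suc n)
  then obtain u where u: "u \<in> verts G"
    by (metis card.empty ex_in_conv nat.distinct(1))
  obtain G' f' where del: "Delete G f u = (G', f')"
    by fastforce
  have verts: "verts G' = verts G - {u}"
    using del by (auto simp: Delete_def pre_digraph.del_vert_simps)
  have card: "card (verts G') = n"
    using Suc.hyps(2) u verts by simp
  have f': "int n \<le> f' v" if "v \<in> verts G'" for v
  proof -
    have "Suc n \<le> f v" using Suc.prems(2) Suc.hyps(2) that verts by auto
    then show ?thesis using del by (auto simp: Delete_def)
  qed
  have step: "legal_step (G, f) (G', nat \<circ> f')"
    using u del by (rule legal_Delete) (use f' in fastforce)
  have "weakly_f_degenerate G' (nat \<circ> f')"
    using Suc.hyps(1)[of G' "nat \<circ> f'"] card verts Suc.prems(1) f' by fastforce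
  then show ?case
    using step unfolding weakly_f_degenerate_def by (meson converse_rtranclp_into_rtranclp)
qed

lemma weakly_degenerate_weak_degeneracy:
  assumes "finite (verts G)"
  shows "weakly_degenerate G (weak_degeneracy G)"
proof -
  have "weakly_degenerate G (card (verts G))"
    using weakly_f_degenerate_if_ge_card[OF assms] by (simp add: weakly_degenerate_def)
  then show ?thesis
    unfolding weak_degeneracy_def by (rule LeastI)
qed

end

theory Submission
  imports Defs
begin

text \<open>
  Consider the excess \<open>2 \<cdot> (\<Sum>v. f v) - 2 \<cdot> |E(G)|\<close>. Removing \<open>u\<close> changes it by \<open>- 2 \<cdot> f u\<close>, plus \<open>2\<close>
  if a neighbour is saved; saving requires \<open>f u > f w \<ge> 0\<close>, so legal steps never increase the
  excess. It is \<open>0\<close> for the empty graph, hence nonnegative for weakly degenerate pairs. For a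
  \<open>d\<close>-regular graph and \<open>f \<equiv> k\<close> it equals \<open>(2k - d) \<cdot> |V(G)|\<close>, and the first step cannot save, so it
  loses \<open>2k\<close>; thus \<open>2k \<le> d\<close> forces \<open>k = d = 0\<close>.
\<close>

text \<open>An arc survives iff both its ends differ from \<open>u\<close>, a condition shared by
  its reverse arc. This invariance lets the one-step estimates be iterated.\<close>

lemma (in graph) graph_del_vert: "graph (del_vert u)"
proof -
  interpret H: fin_digraph "del_vert u" by (rule fin_digraph_del_vert)
  have "\<forall>e1\<in>arcs (del_vert u). \<exists>e2\<in>arcs (del_vert u).
      tail G e1 = head G e2 \<and> head G e1 = tail G e2"
    using sym_arcs unfolding symmetric_conv arcs_del_vert by fastforce
  then show ?thesis
    using no_loops no_multi_arcs
    by unfold_locales (auto simp: del_vert_simps ends_del_vert symmetric_conv)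
qed

text \<open>Without parallel arcs, \<open>head G\<close> is injective on the arcs leaving
  \<open>u\<close>. This links arc counts to the operations, which are phrased by adjacency.\<close>

lemma (in nomulti_digraph) out_degree_eq_card_dominates: "out_degree G u = card {v. u \<rightarrow> v}"
proof -
  have "bij_betw (head G) (out_arcs G u) {v. u \<rightarrow> v}"
    using no_multi_arcs by (force simp: bij_betw_def inj_on_def arc_to_ends_def arcs_ends_conv)
  then show ?thesis by (simp add: out_degree_def bij_betw_same_card)
qed

lemma (in nomulti_digraph) in_degree_eq_card_dominates: "in_degree G u = card {v. v \<rightarrow> u}"
proof -
  have "bij_betw (tail G) (in_arcs G u) {v. v \<rightarrow> u}"
    using no_multi_arcs by (force simp: bij_betw_def inj_on_def arc_to_ends_def arcs_ends_conv)
  then show ?thesis by (simp add: in_degree_def bij_betw_same_card)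
qed

text \<open>The lost arcs are those leaving \<open>u\<close> and those entering \<open>u\<close>:
  disjoint families as there are no loops, and of equal size by symmetry.\<close>

lemma (in graph) card_arcs_del_vert:
  "card (arcs G) = card (arcs (del_vert u)) + 2 * out_degree G u"
proof -
  have split: "arcs G = arcs (del_vert u) \<union> (out_arcs G u \<union> in_arcs G u)"
    by (auto simp: arcs_del_vert)
  have "{v. v \<rightarrow> u} = {v. u \<rightarrow> v}"
    using sym_arcs by (auto intro: arcs_ends_symmetric)
  then have "in_degree G u = out_degree G u"
    by (simp add: in_degree_eq_card_dominates out_degree_eq_card_dominates)
  moreover have "card (out_arcs G u \<union> in_arcs G u) = out_degree G u + in_degree G u"
    unfolding out_degree_def in_degree_def
    by (rule card_Un_disjoint) (auto dest: no_loops)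
  moreover have "card (arcs G) = card (arcs (del_vert u)) + card (out_arcs G u \<union> in_arcs G u)"
    by (subst split, rule card_Un_disjoint) (auto simp: arcs_del_vert)
  ultimately show ?thesis by simp
qed

text \<open>Each edge is a pair of opposite arcs, so \<open>card (arcs G)\<close> is already twice
  the number of edges. The value is an integer because it can be negative.\<close>

definition excess :: "('a, 'b) pre_digraph \<times> ('a \<Rightarrow> nat) \<Rightarrow> int" where
  "excess = (\<lambda>(G, f). 2 * (\<Sum>v\<in>verts G. int (f v)) - int (card (arcs G)))"

text \<open>Common core of both operations: \<open>S\<close> is the set of decremented neighbours,
  namely all of them for \<open>Delete\<close> and all but \<open>w\<close> for
  \<open>DeleteSave\<close>.\<close>

lemma (in graph) excess_del_vert:
  assumes u: "u \<in> verts G" and S: "S \<subseteq> {v. u \<rightarrow> v}"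
    and nonneg: "\<forall>v\<in>verts (del_vert u). 0 \<le> f' v"
    and f': "\<forall>v\<in>verts (del_vert u). f' v = int (f v) - of_bool (v \<in> S)"
  shows "excess (del_vert u, nat \<circ> f') =
    excess (G, f) - 2 * int (f u) + 2 * (int (out_degree G u) - int (card S))"
proof -
  \<comment> \<open>Since \<open>u\<close> is not its own neighbour, every decrement hits a
    remaining vertex, and the sum drops by exactly \<open>card S\<close>.\<close>
  have SV: "S \<subseteq> verts G - {u}"
    using S adj_in_verts adj_not_same by blast
  have "(\<Sum>v\<in>verts (del_vert u). int ((nat \<circ> f') v)) = (\<Sum>v\<in>verts (del_vert u). f' v)"
    using nonneg by (intro sum.cong) simp_all
  also have "\<dots> = (\<Sum>v\<in>verts G - {u}. int (f v) - of_bool (v \<in> S))"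
    using f' by (intro sum.cong) (simp_all add: verts_del_vert)
  also have "\<dots> = (\<Sum>v\<in>verts G - {u}. int (f v)) - int (card S)"
    using SV by (simp add: sum_subtractf of_bool_def sum.If_cases Int_absorb1)
  also have "\<dots> = (\<Sum>v\<in>verts G. int (f v)) - int (f u) - int (card S)"
    using u by (simp add: sum_diff1)
  finally show ?thesis
    using card_arcs_del_vert[of u] by (simp add: excess_def)
qed

lemma (in graph) excess_Delete:
  assumes "u \<in> verts G" "Delete G f u = (G', f')" "\<forall>v\<in>verts G'. f' v \<ge> 0"
  shows "excess (G', nat \<circ> f') = excess (G, f) - 2 * int (f u)"
proof -
  have G': "G' = del_vert u" and f': "\<forall>v. f' v = int (f v) - of_bool (v \<in> {v. u \<rightarrow> v})"
    using assms(2) by (auto simp: Delete_def)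
  have "excess (del_vert u, nat \<circ> f') = excess (G, f) - 2 * int (f u)
      + 2 * (int (out_degree G u) - int (card {v. u \<rightarrow> v}))"
    using assms(1,3) f' unfolding G' by (intro excess_del_vert) blast+
  then show ?thesis by (simp add: G' out_degree_eq_card_dominates)
qed

lemma (in graph) excess_DeleteSave:
  assumes "u \<in> verts G" "u \<rightarrow> w" "DeleteSave G f u w = (G', f')" "\<forall>v\<in>verts G'. f' v \<ge> 0"
  shows "excess (G', nat \<circ> f') = excess (G, f) - 2 * int (f u) + 2"
proof -
  have "finite {v. u \<rightarrow> v}"
    by (rule finite_subset[OF _ finite_verts]) (auto dest: adj_in_verts)
  then have "card {v. u \<rightarrow> v} = Suc (card ({v. u \<rightarrow> v} - {w}))"
    using assms(2) by (intro card.remove) auto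
  then have "int (out_degree G u) - int (card ({v. u \<rightarrow> v} - {w})) = 1"
    by (simp only: out_degree_eq_card_dominates)
  moreover have G': "G' = del_vert u"
    and f': "\<forall>v. f' v = int (f v) - of_bool (v \<in> {v. u \<rightarrow> v} - {w})"
    using assms(3) by (auto simp: DeleteSave_def)
  moreover have "excess (del_vert u, nat \<circ> f') = excess (G, f) - 2 * int (f u)
      + 2 * (int (out_degree G u) - int (card ({v. u \<rightarrow> v} - {w})))"
    using assms(1,4) f' unfolding G' by (intro excess_del_vert) blast+
  ultimately show ?thesis by simp
qed

lemma legal_step_graph:
  assumes "legal_step (G, f) (G', f')" "graph G"
  shows "graph G'"
  using assms by cases (auto simp: Delete_def DeleteSave_def graph.graph_del_vert)

lemma legal_step_excess_le:
  assumes "legal_step (G, f) (G', f')" "graph G"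
  shows "excess (G', f') \<le> excess (G, f)"
  using assms(1)
proof cases
  case (legal_Delete u f1)
  then show ?thesis using graph.excess_Delete[OF assms(2), of u f G' f1] by simp
next
  case (legal_DeleteSave u w f1)
  then show ?thesis using graph.excess_DeleteSave[OF assms(2), of u w f G' f1] by simp
qed

lemma weakly_f_degenerate_excess_nonneg:
  assumes "graph G" "legal_step\<^sup>*\<^sup>* (G, f) (H, g)" "verts H = {}"
  shows "0 \<le> excess (G, f)"
proof -
  have "graph H \<and> excess (H, g) \<le> excess (G, f)"
    using assms(2)
  proof (induction rule: rtranclp_induct2)
    case refl
    then show ?case using assms(1) by simp
  next
    case (step G1 f1 G2 f2)
    then show ?case using legal_step_graph legal_step_excess_le by fastforce
  qed
  moreover have "arcs H = {}" if "graph H"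
    using wf_digraph.tail_in_verts[of H] that assms(3)
    by (auto simp: graph_def digraph_def fin_digraph_def)
  ultimately show ?thesis using assms(3) by (auto simp: excess_def)
qed

text \<open>The arcs are partitioned by their tails.\<close>

lemma (in graph) card_arcs_regular:
  assumes "regular_graph d G"
  shows "card (arcs G) = d * card (verts G)"
proof -
  have "card (\<Union>v\<in>verts G. out_arcs G v) = (\<Sum>v\<in>verts G. out_degree G v)"
    unfolding out_degree_def by (rule card_UN_disjoint) auto
  moreover have "(\<Union>v\<in>verts G. out_arcs G v) = arcs G" by auto
  ultimately show ?thesis using assms by (simp add: regular_graph_def)
qed

lemma regular_weakly_degenerate_gt:
  assumes G: "graph G" and "verts G \<noteq> {}" "d \<ge> 1" "regular_graph d G" "weakly_degenerate G k"
  shows "d < 2 * k"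
proof (rule ccontr)
  assume k: "\<not> d < 2 * k"
  interpret graph G by fact
  obtain H g where "legal_step\<^sup>*\<^sup>* (G, \<lambda>_. k) (H, g)" "verts H = {}"
    using assms(5) by (auto simp: weakly_degenerate_def weakly_f_degenerate_def)
  then obtain G1 f1 where step: "legal_step (G, \<lambda>_. k) (G1, f1)"
    and rest: "legal_step\<^sup>*\<^sup>* (G1, f1) (H, g)"
    \<comment> \<open>An empty run is impossible: \<open>G\<close> has a vertex and \<open>H\<close>
      has none.\<close>
    using assms(2) by (cases rule: converse_rtranclpE) auto
  have "0 \<le> excess (G1, f1)"
    using weakly_f_degenerate_excess_nonneg[OF legal_step_graph[OF step G] rest] \<open>verts H = {}\<close> by simp
  also have "excess (G1, f1) = excess (G, \<lambda>_. k) - 2 * int k"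
    using step
  proof cases
    case (legal_Delete u f')
    then show ?thesis using excess_Delete[of u "\<lambda>_. k" G1 f'] by simp
  \<comment> \<open>Saving would require \<open>k < k\<close>, as the initial function is
    constant.\<close>
  qed simp
  also have "excess (G, \<lambda>_. k) = (2 * int k - int d) * int (card (verts G))"
    using card_arcs_regular[OF assms(4)] by (simp add: excess_def algebra_simps)
  finally have le: "2 * int k \<le> (2 * int k - int d) * int (card (verts G))" by simp
  moreover have "(2 * int k - int d) * int (card (verts G)) \<le> 0"
    using k by (intro mult_nonpos_nonneg) linarith+
  \<comment> \<open>Now \<open>2 * k\<close> is bounded above by a nonpositive number. With
    \<open>k = 0\<close>, \<open>le\<close> says that \<open>d\<close> times the number of vertices
    is at most 0, although both factors are positive.\<close>
  ultimately have "k = 0" by linarith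
  moreover have "0 < card (verts G)" using assms(2) by (simp add: card_gt_0_iff)
  ultimately show False using le assms(3) by (simp add: mult_le_0_iff)
qed

theorem theorem2:
  fixes G :: "('a, 'b) pre_digraph" and d :: nat
  assumes "graph G"
    and "verts G \<noteq> {}"
    and "d \<ge> 1"
    and "regular_graph d G"
  shows "weak_degeneracy G \<ge> d div 2 + 1"
proof -
  have "weakly_degenerate G (weak_degeneracy G)"
    using assms(1) by (intro weakly_degenerate_weak_degeneracy)
      (simp add: graph_def digraph_def fin_digraph.finite_verts)
  then have "d < 2 * weak_degeneracy G"
    using assms by (intro regular_weakly_degenerate_gt)
  then show ?thesis by linarith
qed

end
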